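(* Let $L$, $r$, $\mathbb J$, $\mathbb J'$ be as described in the context and let $\mathcal A\subset L^1_{loc}(\mathbb J,X)$ be linear, positive-invariant and $r'$-invariant, with $(\Delta_1)$ and $\mathcal A\subset\mathcal M\mathcal A$. If $y\in W^{1,m}_{loc}(\mathbb J',X)$, $y_r\in\mathcal A$ and $Ly\in\mathcal M\mathcal A$, then $y^{(j)}_r\in\mathcal A$ for $0<j<m$ and $y^{(m)}|\,\mathbb J\in\mathcal M\mathcal A$.
   Context: $X$ is a Banach space over $\mathbb K=\mathbb R$ or $\mathbb C$, $\mathbb J=[\alpha,\infty)$ with $\alpha\in\mathbb R$. Let $m,n,q\in\mathbb N$, let $a_{j,k}\in\mathbb K^{n\times n}$ ($0\le j\le m-1$, $1\le k\le q$) be constant matrices, and let $r_1<\cdots<r_q$ be reals with $0$ among them. Put $r=r_1\le0$ and $\mathbb J'=[\alpha+r,\infty)$. For $y=(y_1,\dots,y_n)$ with components $y_i:\mathbb J'\to X$ the differential-difference operator $L$ is $$Ly=y^{(m)}+\sum_{j=0}^{m-1}\sum_{k=1}^{q}a_{j,k}\,y^{(j)}_{r_k}\quad\text{on }\mathbb J,$$ where $y_s(t)=y(t+s)$ where defined and $y^{(j)}_s$ is the translate by $s$ of $y^{(j)}$; the matrices act on the $n$ components. Membership such as $y\in\mathcal A$ for $n$-tuples means that each component is in the class. $W^{1,m}_{loc}(\mathbb I,X)$: all $f\in C^{m-1}(\mathbb I,X)$ with $f^{(m-1)}$ locally absolutely continuous on $\mathbb I$ and differentiable a.e. (with $f^{(m)}:=0$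 where $(f^{(m-1)})'$ does not exist; then $f^{(m)}\in L^1_{loc}(\mathbb I,X)$). Positive-invariant: $f_a\in\mathcal A$ for $f\in\mathcal A$, $a\ge0$. $r'$-invariant: if $f\in C^1(\mathbb J',X)$, $f'|\,\mathbb J\in\mathcal A$ and $f_r|\,\mathbb J\in\mathcal A$, then $f'_r|\,\mathbb J\in\mathcal A$ (where $f'_r=(f')_r$). For $h>0$: $M_hf(t)=\frac1h\int_0^hf(t+s)\,ds$; $\mathcal M\mathcal A=\{f\in L^1_{loc}(\mathbb J,X):M_hf\in\mathcal A\ \forall h>0\}$. $(\Delta_1)$: whenever $\phi\in L^1_{loc}(\mathbb J,X)$ and $\phi_s-\phi\in\mathcal A$ for all $s>0$, then $\phi-M_1\phi\in\mathcal A$. *)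

theory Defs
  imports "HOL-Analysis.Analysis"
begin

text \<open>
  Scalars and the Banach space. By Gelfand--Mazur (Ostrowski), a \<^class>\<open>real_normed_field\<close>, whose norm
  is multiplicative, is isometrically isomorphic to the real or the complex numbers, so the type
  variable \<open>'k\<close> below is exactly "the field is R or C". The Banach space is a type of class \<^class>\<open>banach\<close>
  carrying a scalar multiplication over \<open>'k\<close> that extends the real one and is compatible with the norm.
\<close>

locale banach_over = vector_space smul
  for smul :: "'k::real_normed_field \<Rightarrow> 'x::banach \<Rightarrow> 'x" +
  assumes norm_smul: "norm (smul c x) = norm c * norm x"
    and smul_of_real: "smul (of_real u) x = u *\<^sub>R x"

text \<open>
  A function on an interval \<open>I\<close> is a total function on the reals, and every notion below depends
  only on its values on \<open>I\<close>. Where functions are collected into classes on \<open>J\<close> that are parameters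
  of the theory (\<open>L1_loc J\<close>, the class \<open>A\<close>, its mean class), the elements are
  \<^const>\<open>extensional\<close>, i.e. \<^const>\<open>undefined\<close> off \<open>J\<close>, so that such an element is the same thing as a
  function on \<open>J\<close>; accordingly functions are passed through \<^const>\<open>restrict\<close> before membership is asserted.
  Functions are not identified almost everywhere; the reading by equivalence classes is the
  special case of classes \<open>A\<close> that are closed under equality almost everywhere.
\<close>

subsection \<open>Locally Bochner integrable functions\<close>

text \<open>
  The library's Bochner integral is confined to second countable (separable) codomains. For an
  arbitrary Banach space we use Bochner's criterion: strong measurability (almost everywhere limit
  of simple functions) together with integrability of the norm.
\<close>

definition strongly_measurable_on :: "(real \<Rightarrow> 'x::real_normed_vector) \<Rightarrow> real set \<Rightarrow> bool" where
  "strongly_measurable_on f S \<longleftrightarrow>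
    (\<exists>s. (\<forall>i::nat. simple_function lebesgue (s i)) \<and>
         (AE t in lebesgue. t \<in> S \<longrightarrow> (\<lambda>i. s i t) \<longlonglongrightarrow> f t))"

definition bochner_integrable_on :: "(real \<Rightarrow> 'x::real_normed_vector) \<Rightarrow> real set \<Rightarrow> bool" where
  "bochner_integrable_on f S \<longleftrightarrow>
    strongly_measurable_on f S \<and> set_integrable lebesgue S (\<lambda>t. norm (f t))"

definition L1_loc :: "real set \<Rightarrow> (real \<Rightarrow> 'x::real_normed_vector) set" where
  "L1_loc I = {f \<in> extensional I. \<forall>a b. {a..b} \<subseteq> I \<longrightarrow> bochner_integrable_on f {a..b}}"

text \<open>
  The values of integrals are taken with the library's Henstock--Kurzweil \<^const>\<open>integral\<close>, which is
  available for every Banach space. The following lemma records that it extends the Bochner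
  integral: the hypotheses are the clauses of the library's \<open>has_bochner_integral\<close> for a function
  into a Banach space, separable or not.
\<close>

lemma bochner_integral_eq_integral:
  fixes f :: "real \<Rightarrow> 'x::banach"
  assumes "\<And>i. Bochner_Integration.simple_bochner_integrable (lebesgue_on {a..b}) (s i)"
    and "\<And>i. (\<lambda>t. norm (f t - s i t)) \<in> borel_measurable (lebesgue_on {a..b})"
    and "(\<lambda>i. \<integral>\<^sup>+t. norm (f t - s i t) \<partial>lebesgue_on {a..b}) \<longlonglongrightarrow> 0"
    and "(\<lambda>i. Bochner_Integration.simple_bochner_integral (lebesgue_on {a..b}) (s i)) \<longlonglongrightarrow> x"
  shows "(f has_integral x) {a..b}"
proof -
  have simple: "(g has_integral Bochner_Integration.simple_bochner_integral (lebesgue_on {a..b}) g) {a..b}"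
    if g: "Bochner_Integration.simple_bochner_integrable (lebesgue_on {a..b}) g" for g :: "real \<Rightarrow> 'x"
  proof -
    have sf: "simple_function (lebesgue_on {a..b}) g"
      using g by (auto simp: simple_bochner_integrable.simps)
    let ?S = "g ` {a..b}"
    have fin: "finite ?S" using sf by (simp add: simple_function_def)
    have one: "((\<lambda>t. indicat_real {t \<in> {a..b}. g t = y} t *\<^sub>R y) has_integral
        measure (lebesgue_on {a..b}) {t \<in> {a..b}. g t = y} *\<^sub>R y) {a..b}" if "y \<in> ?S" for y
    proof -
      have eq: "g -` {y} \<inter> {a..b} = {t \<in> {a..b}. g t = y}" by auto
      have "{t \<in> {a..b}. g t = y} \<in> sets (lebesgue_on {a..b})"
        using simple_functionD(2)[OF sf, of "{y}"] eq by (simp add: space_restrict_space)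
      then have L: "{t \<in> {a..b}. g t = y} \<in> sets lebesgue"
        by (simp add: sets_restrict_space_iff)
      have "{t \<in> {a..b}. g t = y} \<in> lmeasurable"
        by (rule bounded_set_imp_lmeasurable[OF _ L]) (rule bounded_subset[OF bounded_closed_interval], blast)
      then have "(indicat_real {t \<in> {a..b}. g t = y} has_integral
          measure lebesgue {t \<in> {a..b}. g t = y}) UNIV"
        by (simp add: lmeasurable_iff_has_integral)
      then have "(indicat_real {t \<in> {a..b}. g t = y} has_integral
          measure lebesgue {t \<in> {a..b}. g t = y}) {a..b}"
        by (rule has_integral_spike_set_eq[THEN iffD1, rotated 2]) (auto intro!: empty_imp_negligible)
      moreover have "measure (lebesgue_on {a..b}) {t \<in> {a..b}. g t = y}
          = measure lebesgue {t \<in> {a..b}. g t = y}"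
        by (rule measure_restrict_space) auto
      ultimately show ?thesis by (simp only: has_integral_scaleR_left)
    qed
    have "((\<lambda>t. \<Sum>y\<in>?S. indicat_real {t \<in> {a..b}. g t = y} t *\<^sub>R y) has_integral
        (\<Sum>y\<in>?S. measure (lebesgue_on {a..b}) {t \<in> {a..b}. g t = y} *\<^sub>R y)) {a..b}"
      by (rule has_integral_sum[OF fin one])
    moreover have "(\<Sum>y\<in>?S. indicat_real {t \<in> {a..b}. g t = y} t *\<^sub>R y) = g t"
      if t: "t \<in> {a..b}" for t
    proof -
      have "(\<Sum>y\<in>?S. indicat_real {t \<in> {a..b}. g t = y} t *\<^sub>R y)
          = (\<Sum>y\<in>?S. if y = g t then y else 0)"
        using t by (intro sum.cong) (auto simp: indicator_def)
      then show ?thesis using fin t by simp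
    qed
    ultimately show ?thesis
      unfolding simple_bochner_integral_def space_lebesgue_on by (rule has_integral_eq[rotated])
  qed
  show ?thesis
    unfolding box_real[symmetric] has_integral
  proof (intro allI impI)
    fix e :: real assume e: "e > 0"
    have "eventually (\<lambda>i. (\<integral>\<^sup>+t. norm (f t - s i t) \<partial>lebesgue_on {a..b}) < ennreal (e/4)) sequentially"
      by (rule order_tendstoD(2)[OF assms(3)]) (use e in simp)
    moreover have "eventually (\<lambda>i. dist (Bochner_Integration.simple_bochner_integral (lebesgue_on {a..b}) (s i)) x < e/4)
        sequentially"
      by (rule tendstoD[OF assms(4)]) (use e in simp)
    ultimately have "eventually (\<lambda>i. (\<integral>\<^sup>+t. norm (f t - s i t) \<partial>lebesgue_on {a..b}) < ennreal (e/4) \<and>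
        dist (Bochner_Integration.simple_bochner_integral (lebesgue_on {a..b}) (s i)) x < e/4)
        sequentially" by (rule eventually_conj)
    then obtain i where
      i1: "(\<integral>\<^sup>+t. norm (f t - s i t) \<partial>lebesgue_on {a..b}) < ennreal (e/4)" and
      i2: "dist (Bochner_Integration.simple_bochner_integral (lebesgue_on {a..b}) (s i)) x < e/4"
      by (auto dest: eventually_happens'[OF sequentially_bot])
    define d where "d = (\<lambda>t. norm (f t - s i t))"
    define I where "I = Bochner_Integration.simple_bochner_integral (lebesgue_on {a..b}) (s i)"
    have int: "integrable (lebesgue_on {a..b}) d"
      unfolding d_def using assms(2)[of i] i1
      by (intro integrableI_nonneg) (auto intro: order_less_trans)
    have dhas: "(d has_integral integral\<^sup>L (lebesgue_on {a..b}) d) {a..b}"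
      using has_integral_integral_lebesgue_on[OF int] by simp
    have dle: "integral\<^sup>L (lebesgue_on {a..b}) d < e/4"
    proof -
      have "ennreal (integral\<^sup>L (lebesgue_on {a..b}) d) < ennreal (e/4)"
        using i1 nn_integral_eq_integral[OF int] unfolding d_def by simp
      then show ?thesis using e by (simp add: ennreal_less_iff d_def)
    qed
    obtain G1 where G1: "gauge G1" "\<And>D. D tagged_division_of cbox a b \<Longrightarrow> G1 fine D \<Longrightarrow>
        norm ((\<Sum>(u,k)\<in>D. measure lborel k *\<^sub>R d u) - integral\<^sup>L (lebesgue_on {a..b}) d) < e/4"
      using dhas[unfolded box_real[symmetric] has_integral, rule_format, of "e/4"] e by auto
    obtain G2 where G2: "gauge G2" "\<And>D. D tagged_division_of cbox a b \<Longrightarrow> G2 fine D \<Longrightarrow>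
        norm ((\<Sum>(u,k)\<in>D. measure lborel k *\<^sub>R s i u) - I) < e/4"
      using simple[OF assms(1)[of i], folded I_def, unfolded box_real[symmetric] has_integral,
        rule_format, of "e/4"] e by auto
    show "\<exists>\<gamma>. gauge \<gamma> \<and> (\<forall>D. D tagged_division_of cbox a b \<and> \<gamma> fine D \<longrightarrow>
        norm ((\<Sum>(u,k)\<in>D. measure lborel k *\<^sub>R f u) - x) < e)"
    proof (intro exI conjI allI impI)
      show "gauge (\<lambda>t. G1 t \<inter> G2 t)" using G1(1) G2(1) by (rule gauge_Int)
      fix D assume D: "D tagged_division_of cbox a b \<and> (\<lambda>t. G1 t \<inter> G2 t) fine D"
      have f1: "norm ((\<Sum>(u,k)\<in>D. measure lborel k *\<^sub>R d u) - integral\<^sup>L (lebesgue_on {a..b}) d) < e/4"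
        and f2: "norm ((\<Sum>(u,k)\<in>D. measure lborel k *\<^sub>R s i u) - I) < e/4"
        using D G1(2) G2(2) by (auto simp: fine_Int)
      have "norm ((\<Sum>(u,k)\<in>D. measure lborel k *\<^sub>R f u) - (\<Sum>(u,k)\<in>D. measure lborel k *\<^sub>R s i u))
          = norm (\<Sum>(u,k)\<in>D. measure lborel k *\<^sub>R (f u - s i u))"
        by (simp add: sum_subtractf[symmetric] split_def scaleR_diff_right)
      also have "\<dots> \<le> (\<Sum>(u,k)\<in>D. measure lborel k *\<^sub>R d u)"
        unfolding d_def split_def by (intro sum_norm_le) simp
      finally have f3: "norm ((\<Sum>(u,k)\<in>D. measure lborel k *\<^sub>R f u) - (\<Sum>(u,k)\<in>D. measure lborel k *\<^sub>R s i u))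
          \<le> (\<Sum>(u,k)\<in>D. measure lborel k *\<^sub>R d u)" .
      have f4: "(\<Sum>(u,k)\<in>D. measure lborel k *\<^sub>R d u) < e/2" using f1 dle unfolding real_norm_def abs_less_iff by linarith
      have f5: "norm (I - x) < e/4" using i2 by (simp add: I_def dist_norm)
      show "norm ((\<Sum>(u,k)\<in>D. measure lborel k *\<^sub>R f u) - x) < e"
        using f2 f3 f4 f5
          dist_triangle[of "\<Sum>(u,k)\<in>D. measure lborel k *\<^sub>R f u" x "\<Sum>(u,k)\<in>D. measure lborel k *\<^sub>R s i u"]
          dist_triangle[of "\<Sum>(u,k)\<in>D. measure lborel k *\<^sub>R s i u" x I]
        unfolding dist_norm by linarith
    qed
  qed
qed

subsection \<open>Derivatives and Sobolev functions on an interval\<close>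

text \<open>
  Derivatives are taken within \<open>I\<close> (one-sided at an end point in \<open>I\<close>) and are set to 0 where they do
  not exist.
\<close>

primrec deriv_on :: "real set \<Rightarrow> nat \<Rightarrow> (real \<Rightarrow> 'x::real_normed_vector) \<Rightarrow> real \<Rightarrow> 'x" where
  "deriv_on I 0 f = f"
| "deriv_on I (Suc j) f =
    (\<lambda>t. if deriv_on I j f differentiable (at t within I)
         then vector_derivative (deriv_on I j f) (at t within I) else 0)"

definition Ck_on :: "nat \<Rightarrow> real set \<Rightarrow> (real \<Rightarrow> 'x::real_normed_vector) set" where
  "Ck_on k I = {f. (\<forall>j<k. \<forall>t\<in>I. deriv_on I j f differentiable (at t within I)) \<and>
                   continuous_on I (deriv_on I k f)}"

definition abs_continuous_on :: "real set \<Rightarrow> (real \<Rightarrow> 'x::real_normed_vector) \<Rightarrow> bool" where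
  "abs_continuous_on S f \<longleftrightarrow>
    (\<forall>\<epsilon>>0. \<exists>\<delta>>0. \<forall>D T. D division_of T \<and> T \<subseteq> S \<and> (\<Sum>K\<in>D. Sup K - Inf K) < \<delta> \<longrightarrow>
       (\<Sum>K\<in>D. norm (f (Sup K) - f (Inf K))) < \<epsilon>)"

text \<open>For \<open>m \<ge> 1\<close>:\<close>

definition W1_loc :: "nat \<Rightarrow> real set \<Rightarrow> (real \<Rightarrow> 'x::real_normed_vector) set" where
  "W1_loc m I = {f \<in> Ck_on (m - 1) I.
      (\<forall>a b. {a..b} \<subseteq> I \<longrightarrow> abs_continuous_on {a..b} (deriv_on I (m - 1) f)) \<and>
      (AE t in lebesgue. t \<in> I \<longrightarrow> deriv_on I (m - 1) f differentiable (at t within I))}"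

subsection \<open>Classes of functions\<close>

definition translate :: "real \<Rightarrow> (real \<Rightarrow> 'x) \<Rightarrow> real \<Rightarrow> 'x" where
  "translate s f = (\<lambda>t. f (t + s))"

definition mean :: "real \<Rightarrow> (real \<Rightarrow> 'x::real_normed_vector) \<Rightarrow> real \<Rightarrow> 'x" where
  "mean h f = (\<lambda>t. (1 / h) *\<^sub>R integral {0..h} (\<lambda>s. f (t + s)))"

definition mean_class ::
    "real set \<Rightarrow> (real \<Rightarrow> 'x::real_normed_vector) set \<Rightarrow> (real \<Rightarrow> 'x) set" where
  "mean_class J A = {f \<in> L1_loc J. \<forall>h>0. restrict (mean h f) J \<in> A}"

definition linear_class :: "('k \<Rightarrow> 'x \<Rightarrow> 'x) \<Rightarrow> real set \<Rightarrow> (real \<Rightarrow> 'x::ab_group_add) set \<Rightarrow> bool" where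
  "linear_class smul J A \<longleftrightarrow>
    restrict (\<lambda>t. 0) J \<in> A \<and>
    (\<forall>f\<in>A. \<forall>g\<in>A. restrict (\<lambda>t. f t + g t) J \<in> A) \<and>
    (\<forall>c. \<forall>f\<in>A. restrict (\<lambda>t. smul c (f t)) J \<in> A)"

definition positive_invariant :: "real set \<Rightarrow> (real \<Rightarrow> 'x) set \<Rightarrow> bool" where
  "positive_invariant J A \<longleftrightarrow> (\<forall>f\<in>A. \<forall>a\<ge>0. restrict (translate a f) J \<in> A)"

definition r'_invariant ::
    "real \<Rightarrow> real \<Rightarrow> (real \<Rightarrow> 'x::real_normed_vector) set \<Rightarrow> bool" where
  "r'_invariant \<alpha> r A \<longleftrightarrow>
    (\<forall>f \<in> Ck_on 1 {\<alpha> + r..}.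
       restrict (deriv_on {\<alpha> + r..} 1 f) {\<alpha>..} \<in> A \<and> restrict (translate r f) {\<alpha>..} \<in> A \<longrightarrow>
       restrict (translate r (deriv_on {\<alpha> + r..} 1 f)) {\<alpha>..} \<in> A)"

definition Delta1 :: "real set \<Rightarrow> (real \<Rightarrow> 'x::real_normed_vector) set \<Rightarrow> bool" where
  "Delta1 J A \<longleftrightarrow>
    (\<forall>\<phi> \<in> L1_loc J. (\<forall>s>0. restrict (\<lambda>t. translate s \<phi> t - \<phi> t) J \<in> A) \<longrightarrow>
       restrict (\<lambda>t. \<phi> t - mean 1 \<phi> t) J \<in> A)"

subsection \<open>The differential-difference operator\<close>

text \<open>
  \<open>I\<close> is the interval on which \<open>y\<close> lives; the shifts are \<open>\<rho> 1, \<dots>, \<rho> q\<close>. The \<open>i\<close>-th component of the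
  value at \<open>y = (y\<^sub>l)\<close>, to be evaluated at points \<open>t\<close> with all \<open>t + \<rho> k\<close> in \<open>I\<close>:
\<close>

definition diff_difference_op ::
    "('k \<Rightarrow> 'x \<Rightarrow> 'x) \<Rightarrow> real set \<Rightarrow> nat \<Rightarrow> nat \<Rightarrow> (nat \<Rightarrow> nat \<Rightarrow> 'k^'n::finite^'n) \<Rightarrow> (nat \<Rightarrow> real) \<Rightarrow>
     ('n \<Rightarrow> real \<Rightarrow> 'x::real_normed_vector) \<Rightarrow> 'n \<Rightarrow> real \<Rightarrow> 'x" where
  "diff_difference_op smul I m q a \<rho> y i t =
    deriv_on I m (y i) t +
    (\<Sum>j<m. \<Sum>k=1..q. \<Sum>l\<in>UNIV. smul (a j k $ i $ l) (translate (\<rho> k) (deriv_on I j (y l)) t))"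

end

theory Submission
  imports Defs
begin

text \<open>
  Two mechanisms move membership in the class \<open>A\<close> up and down the chain of derivatives of \<open>y\<close>.
  Write \<open>increment h f\<close> for the function \<open>t \<mapsto> f (t + h) - f t\<close>.

  Downwards: \<open>h\<close> times the mean of a derivative over \<open>[t, t + h]\<close> is an increment of the function.
  Averaging \<open>Ly\<close> therefore turns \<open>Ly \<in> \<M>A\<close> into the statement that the increments of an operator
  of order \<open>m - 1\<close>, whose coefficients are those of \<open>L\<close> moved down by one, lie in \<open>A\<close>; the term in
  which \<open>y\<close> itself occurs has means in \<open>A\<close> and drops out (\<open>reduce_order\<close>).

  Upwards: if the translate of \<open>f\<close> by \<open>r\<close> and all increments of \<open>f'\<close> belong to \<open>A\<close>, then by
  \<open>(\<Delta>\<^sub>1)\<close> so does \<open>f' - M\<^sub>1 f'\<close>, and \<open>M\<^sub>1 f'\<close> is the increment of \<open>f\<close> over 1; hence \<open>f' \<in> A\<close> on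
  \<open>[\<alpha>, \<infinity>)\<close>, and \<open>r'\<close>-invariance carries this back to the translate by \<open>r\<close>
  (\<open>derivative_in_class_of_increments\<close>).

  The theorem follows by induction on the order (\<open>derivatives_in_class\<close>). Suppose that the
  increments of an operator of order \<open>N + 1\<close> applied to \<open>y\<close> lie in \<open>A\<close>. For each fixed \<open>h\<close> this is an
  equation of order \<open>N + 1\<close> for \<open>increment h y\<close> with right-hand side in \<open>A \<subseteq> \<M>A\<close>, so one more
  averaging leads to order \<open>N\<close>, and the induction hypothesis puts the increments of \<open>y, y', \<dots>, y\<^bsup>(N)\<^esup>\<close>
  in \<open>A\<close>. The upward step removes the increments from these one after the other. All
  the lower order terms of the operator are now known to be in \<open>A\<close>, thus the increments of \<open>y\<^bsup>(N+1)\<^esup>\<close>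
  are too, and a last upward step concludes.

  The top derivative \<open>y\<^bsup>(m)\<^esup>\<close> exists only almost everywhere. That its integrals are the increments of
  \<open>y\<^bsup>(m-1)\<^esup>\<close> is the fundamental theorem of calculus for absolutely continuous functions, proved here for
  the Henstock--Kurzweil integral; its local Bochner integrability is read off from the equation,
  which expresses it as \<open>Ly\<close> minus a continuous function.
\<close>

section \<open>The fundamental theorem of calculus for absolutely continuous functions\<close>

text \<open>
  The proof is by Riemann sums. Intervals tagged outside the exceptional set \<open>N\<close> are controlled by
  the derivative, as in the classical fundamental theorem. Intervals tagged in \<open>N\<close> are forced by the
  gauge into an open set of measure below \<open>\<delta>\<close>, and absolute continuity bounds their increments.
\<close>

lemma has_integral_derivative_of_abs_continuous:
  fixes f :: "real \<Rightarrow> 'a::banach"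
  assumes "a \<le> b"
    and ac: "abs_continuous_on {a..b} f"
    and N: "negligible N"
    and der: "\<And>x. x \<in> {a..b} - N \<Longrightarrow> (f has_vector_derivative g x) (at x within {a..b})"
  shows "(g has_integral (f b - f a)) {a..b}"
proof (cases "a = b")
  case True
  then show ?thesis by (simp add: has_integral_refl)
next
  case False
  then have ab: "a < b" using assms(1) by simp
  \<comment> \<open>The integrand is put to 0 on \<open>N\<close>, where its values do not matter, so that intervals
    tagged there contribute nothing to the Riemann sum.\<close>
  define f' where "f' x = (if x \<in> N then 0 else g x)" for x
  have "(f' has_integral (f b - f a)) {a..b}"
    unfolding has_integral_factor_content box_real[symmetric]
  proof safe
    fix e :: real
    assume e: "e > 0"
    have "\<forall>x. \<exists>d>0. x \<in> {a..b} - N \<longrightarrow>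
           (\<forall>y\<in>{a..b}. norm (y-x) < d \<longrightarrow> norm (f y - f x - (y-x) *\<^sub>R f' x) \<le> (e/2) * norm (y-x))"
    proof
      fix x
      show "\<exists>d>0. x \<in> {a..b} - N \<longrightarrow>
           (\<forall>y\<in>{a..b}. norm (y-x) < d \<longrightarrow> norm (f y - f x - (y-x) *\<^sub>R f' x) \<le> (e/2) * norm (y-x))"
      proof (cases "x \<in> {a..b} - N")
        case True
        then have "\<forall>e>0. \<exists>d>0. \<forall>y\<in>{a..b}. norm (y - x) < d \<longrightarrow>
            norm (f y - f x - (y - x) *\<^sub>R f' x) \<le> e * norm (y - x)"
          using der[OF True] unfolding has_vector_derivative_def has_derivative_within_alt f'_def by simp
        then show ?thesis using half_gt_zero[OF e] by blast
      qed (auto intro: exI[of _ 1])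
    qed
    then obtain d where d: "\<And>x. 0 < d x"
       "\<And>x y. \<lbrakk>x \<in> {a..b} - N; y \<in> {a..b}; norm (y-x) < d x\<rbrakk>
          \<Longrightarrow> norm (f y - f x - (y-x) *\<^sub>R f' x) \<le> (e/2) * norm (y-x)"
      by metis
    have e2: "e * (b - a) / 2 > 0" using e ab by simp
    obtain \<delta> where \<delta>: "\<delta> > 0"
      "\<And>D T. D division_of T \<Longrightarrow> T \<subseteq> {a..b} \<Longrightarrow> (\<Sum>K\<in>D. Sup K - Inf K) < \<delta> \<Longrightarrow>
         (\<Sum>K\<in>D. norm (f (Sup K) - f (Inf K))) < e * (b - a) / 2"
      using ac e2 unfolding abs_continuous_on_def by metis
    have Nl: "N \<in> null_sets lebesgue" using N by (simp add: negligible_iff_null_sets)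
    obtain U where U: "open U" "N \<subseteq> U" "(U - N) \<in> lmeasurable" "emeasure lebesgue (U - N) < ennreal \<delta>"
      using sets_lebesgue_outer_open[OF null_setsD2[OF Nl] \<delta>(1)] by blast
    have emU: "emeasure lebesgue U < ennreal \<delta>"
      using emeasure_Un_null_set[OF fmeasurableD[OF U(3)] Nl] U(2,4)
      by (simp add: Un_absorb2)
    have Ul: "U \<in> lmeasurable"
      using U(1) order_less_trans[OF emU ennreal_less_top]
      by (intro fmeasurableI) (simp_all add: infinity_ennreal_def)
    have mU: "measure lebesgue U < \<delta>"
      using emU \<delta>(1) by (simp add: emeasure_eq_measure2[OF Ul] ennreal_less_iff)
    define G where "G x = (if x \<in> N then U else ball x (d x))" for x
    have gauge: "gauge G" using d(1) U unfolding gauge_def G_def by auto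
    have approx: "norm ((\<Sum>(x, K)\<in>p. measure lborel K *\<^sub>R f' x) - (f b - f a)) \<le> e * measure lborel (cbox a b)"
      if ptag: "p tagged_division_of cbox a b" and fine: "G fine p" for p
    proof -
      have fin: "finite p" using ptag by (rule tagged_division_ofD(1))
      have ba: "b - a = (\<Sum>(x,K)\<in>p. Sup K - Inf K)" "f b - f a = (\<Sum>(x,K)\<in>p. f(Sup K) - f(Inf K))"
        using additive_tagged_division_1[where f= "\<lambda>x. x"] additive_tagged_division_1[where f= f]
              \<open>a \<le> b\<close> ptag by auto
      define P where "P = {z \<in> p. fst z \<in> N}"
      define err where "err z = (case z of (x, K) \<Rightarrow> measure lborel K *\<^sub>R f' x - (f (Sup K) - f (Inf K)))" for z
      have interval: "\<exists>u v. K = {u..v} \<and> u \<le> v \<and> x \<in> {u..v} \<and> {u..v} \<subseteq> {a..b}" if xK: "(x, K) \<in> p" for x K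
      proof -
        obtain u v where "K = cbox u v" using tagged_division_ofD(4)[OF ptag xK] by blast
        moreover have "x \<in> K" "K \<subseteq> cbox a b" using tagged_division_ofD(2,3)[OF ptag xK] by auto
        ultimately show ?thesis by (intro exI[of _ u] exI[of _ v]) auto
      qed
      have regular: "norm (err z) \<le> (e/2) * (Sup (snd z) - Inf (snd z))" if "z \<in> p - P" for z
      proof -
        obtain x K where z: "z = (x, K)" by (cases z)
        have xK: "(x, K) \<in> p" "x \<notin> N" using that by (auto simp: z P_def)
        obtain u v where k: "K = {u..v}" "u \<le> v" "x \<in> {u..v}" "{u..v} \<subseteq> {a..b}"
          using interval[OF xK(1)] by blast
        have "K \<subseteq> ball x (d x)" using fineD[OF fine xK(1)] xK(2) by (simp add: G_def)
        moreover have "u \<in> K" "v \<in> K" using k by auto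
        ultimately have "u \<in> ball x (d x)" "v \<in> ball x (d x)" by blast+
        then have near: "norm (u - x) < d x" "norm (v - x) < d x"
          by (simp_all add: dist_norm norm_minus_commute)
        have mem: "x \<in> {a..b} - N" "u \<in> {a..b}" "v \<in> {a..b}" using k xK(2) by auto
        have "norm ((v - u) *\<^sub>R f' x - (f v - f u))
            = norm (f u - f x - (u - x) *\<^sub>R f' x - (f v - f x - (v - x) *\<^sub>R f' x))"
          by (auto simp: algebra_simps)
        also have "\<dots> \<le> (e/2) * norm (u - x) + (e/2) * norm (v - x)"
          by (rule order_trans[OF norm_triangle_ineq4 add_mono[OF d(2)[OF mem(1,2) near(1)] d(2)[OF mem(1,3) near(2)]]])
        also have "\<dots> = (e/2) * (v - u)"
          using k by (simp add: field_simps)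
        finally show ?thesis using k by (simp add: z err_def)
      qed
      have "norm (\<Sum>z\<in>p - P. err z) \<le> (\<Sum>z\<in>p - P. (e/2) * (Sup (snd z) - Inf (snd z)))"
        by (rule sum_norm_le[OF regular])
      also have "\<dots> \<le> (\<Sum>z\<in>p. (e/2) * (Sup (snd z) - Inf (snd z)))"
        using e interval by (intro sum_mono2[OF fin]) fastforce+
      also have "\<dots> = e * (b - a) / 2"
        unfolding sum_distrib_left[symmetric] by (simp add: ba(1) case_prod_beta)
      finally have 1: "norm (\<Sum>z\<in>p - P. err z) \<le> e * (b - a) / 2" .
      have "P tagged_partial_division_of cbox a b"
        using ptag by (auto simp: P_def tagged_division_of_def intro: tagged_partial_division_subset)
      note Ptag = tagged_partial_division_of_Union_self[OF this]
        and Pdiv = partial_division_of_tagged_division[OF this]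
      \<comment> \<open>Rewriting sums over tagged intervals as sums over intervals asks for a summand that vanishes
        on all degenerate intervals, among them the empty set, whose \<open>Sup\<close> and \<open>Inf\<close> are unspecified.\<close>
      define jump where "jump K = (if K = {} then 0 else norm (f (Sup K) - f (Inf K)))" for K
      have jump: "norm (f (Sup K) - f (Inf K)) = jump K" if "(x, K) \<in> P" for x K
        using interval that by (fastforce simp: P_def jump_def)
      have "(\<Sum>K\<in>snd ` P. Sup K - Inf K) = (\<Sum>K\<in>snd ` P. measure lebesgue K)"
      proof (rule sum.cong[OF refl])
        fix K assume "K \<in> snd ` P"
        then obtain x where "(x, K) \<in> p" by (auto simp: P_def)
        from interval[OF this] obtain u v where "K = {u..v}" "u \<le> v" by blast
        then show "Sup K - Inf K = measure lebesgue K" by simp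
      qed
      also have "\<dots> = measure lebesgue (\<Union>(snd ` P))"
        by (rule content_division[OF Pdiv])
      also have "\<dots> \<le> measure lebesgue U"
      proof (rule measure_mono_fmeasurable[OF _ _ Ul])
        show "\<Union>(snd ` P) \<subseteq> U" using fine by (fastforce simp: P_def fine_def G_def)
        show "\<Union>(snd ` P) \<in> sets lebesgue" using lmeasurable_division[OF Pdiv] by blast
      qed
      finally have "(\<Sum>K\<in>snd ` P. Sup K - Inf K) < \<delta>" using mU by simp
      moreover have "\<Union>(snd ` P) \<subseteq> {a..b}" using interval by (fastforce simp: P_def)
      ultimately have small: "(\<Sum>K\<in>snd ` P. norm (f (Sup K) - f (Inf K))) < e * (b - a) / 2"
        by (intro \<delta>(2)[OF Pdiv])
      have "norm (\<Sum>z\<in>P. err z) \<le> (\<Sum>z\<in>P. norm (f (Sup (snd z)) - f (Inf (snd z))))"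
        by (intro sum_norm_le) (auto simp: P_def err_def f'_def norm_minus_commute)
      also have "\<dots> = (\<Sum>(x, K)\<in>P. jump K)"
        by (intro sum.cong) (auto simp: jump)
      also have "\<dots> = (\<Sum>K\<in>snd ` P. jump K)"
        by (rule sum.over_tagged_division_lemma[OF Ptag]) (auto simp: jump_def)
      also have "\<dots> = (\<Sum>K\<in>snd ` P. norm (f (Sup K) - f (Inf K)))"
        by (intro sum.cong) (auto simp: jump)
      finally have 2: "norm (\<Sum>z\<in>P. err z) \<le> e * (b - a) / 2" using small by simp
      have "(\<Sum>(x, K)\<in>p. measure lborel K *\<^sub>R f' x) - (f b - f a) = (\<Sum>z\<in>p. err z)"
        by (simp add: ba(2) err_def case_prod_beta sum_subtractf)
      also have "\<dots> = (\<Sum>z\<in>p - P. err z) + (\<Sum>z\<in>P. err z)"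
        by (rule sum.subset_diff) (use fin in \<open>auto simp: P_def\<close>)
      finally have "norm ((\<Sum>(x, K)\<in>p. measure lborel K *\<^sub>R f' x) - (f b - f a))
          \<le> norm (\<Sum>z\<in>p - P. err z) + norm (\<Sum>z\<in>P. err z)"
        by (metis norm_triangle_ineq)
      then show ?thesis using 1 2 ab by simp
    qed
    show "\<exists>G. gauge G \<and> (\<forall>p. p tagged_division_of (cbox a b) \<and> G fine p \<longrightarrow>
        norm ((\<Sum>(x, K)\<in>p. measure lborel K *\<^sub>R f' x) - (f b - f a)) \<le> e * measure lborel (cbox a b))"
    proof (intro exI[of _ G] conjI allI impI gauge)
      fix p assume "p tagged_division_of cbox a b \<and> G fine p"
      then show "norm ((\<Sum>(x, K)\<in>p. measure lborel K *\<^sub>R f' x) - (f b - f a)) \<le> e * measure lborel (cbox a b)"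
        by (intro approx) simp_all
    qed
  qed
  then show ?thesis
    by (rule has_integral_spike[OF N, rotated]) (simp add: f'_def)
qed

section \<open>Local Bochner integrability\<close>

text \<open>
  The simple functions take the values of \<open>f\<close> on a grid of mesh \<open>1 / (i + 1)\<close>: the point \<open>p i t\<close> is the
  grid point just below \<open>t\<close>, after \<open>t\<close> has been clipped to \<open>[a, b]\<close> to keep the grid finite.
\<close>

lemma strongly_measurable_on_continuous:
  fixes f :: "real \<Rightarrow> 'a::real_normed_vector"
  assumes cont: "continuous_on {a..b} f"
  shows "strongly_measurable_on f {a..b}"
proof (cases "a \<le> b")
  case False
  then show ?thesis
    unfolding strongly_measurable_on_def by (intro exI[of _ "\<lambda>i t. 0"]) simp
next
  case True
  define u where "u t = max a (min b t)" for t
  define k where "k i t = \<lfloor>real (Suc i) * (u t - a)\<rfloor>" for i t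
  define p where "p i t = a + real_of_int (k i t) / real (Suc i)" for i t
  have u: "a \<le> u t" "u t \<le> b" for t using True by (auto simp: u_def)
  have k: "0 \<le> k i t" "real_of_int (k i t) \<le> real (Suc i) * (u t - a)"
      "real (Suc i) * (u t - a) < real_of_int (k i t) + 1" for i t
    using u[of t] unfolding k_def by simp_all
  have p: "a \<le> p i t" "p i t \<le> u t" "u t - p i t \<le> 1 / real (Suc i)" for i t
  proof -
    have "u t - p i t = (real (Suc i) * (u t - a) - real_of_int (k i t)) / real (Suc i)"
      by (simp add: p_def diff_divide_distrib)
    moreover have "\<dots> \<le> 1 / real (Suc i)"
      using k(3)[of i t] by (intro divide_right_mono) linarith+
    moreover have "0 \<le> (real (Suc i) * (u t - a) - real_of_int (k i t)) / real (Suc i)"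
      using k(2)[of i t] by (intro divide_nonneg_nonneg) linarith+
    moreover have "0 \<le> real_of_int (k i t) / real (Suc i)" using k(1)[of i t] by simp
    ultimately show "a \<le> p i t" "p i t \<le> u t" "u t - p i t \<le> 1 / real (Suc i)"
      unfolding p_def by linarith+
  qed
  have simple: "simple_function lebesgue (\<lambda>t. f (p i t))" for i
  proof -
    have "k i t \<le> \<lfloor>real (Suc i) * (b - a)\<rfloor>" for t
      unfolding k_def using u[of t] by (intro floor_mono mult_left_mono) auto
    then have "range (k i) \<subseteq> {0..\<lfloor>real (Suc i) * (b - a)\<rfloor>}" using k(1) by auto
    then have "finite (range (k i))" by (rule finite_subset) simp
    moreover have "k i -` {k i x} \<in> sets lebesgue" for x
    proof -
      have "(\<lambda>t. k i t) \<in> borel \<rightarrow>\<^sub>M count_space UNIV"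
        unfolding k_def u_def by measurable
      from measurable_sets[OF this, of "{k i x}"] show ?thesis by simp
    qed
    ultimately have "simple_function lebesgue (k i)"
      by (simp add: simple_function_def)
    then show ?thesis
      unfolding p_def by (rule simple_function_compose1)
  qed
  have "(\<lambda>i. f (p i t)) \<longlonglongrightarrow> f t" if t: "t \<in> {a..b}" for t
  proof (rule continuous_on_tendsto_compose[OF cont _ t])
    have ut: "u t = t" using t by (simp add: u_def)
    have lim: "(\<lambda>i. t - 1 / real (Suc i)) \<longlonglongrightarrow> t - 0"
      by (intro tendsto_intros LIMSEQ_Suc lim_1_over_n)
    show "(\<lambda>i. p i t) \<longlonglongrightarrow> t"
    proof (rule tendsto_sandwich[OF _ _ _ tendsto_const])
      show "(\<lambda>i. t - 1 / real (Suc i)) \<longlonglongrightarrow> t" using lim by simp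
      show "\<forall>\<^sub>F i in sequentially. t - 1 / real (Suc i) \<le> p i t"
        using p(3)[of t] by (auto simp: ut algebra_simps)
      show "\<forall>\<^sub>F i in sequentially. p i t \<le> t" using p(2)[of _ t] by (simp add: ut)
    qed
    show "\<forall>\<^sub>F i in sequentially. p i t \<in> {a..b}"
      using p(1,2)[of _ t] t by (auto simp: ut intro!: always_eventually intro: order_trans[of _ t])
  qed
  with simple show ?thesis
    unfolding strongly_measurable_on_def by (intro exI[of _ "\<lambda>i t. f (p i t)"]) auto
qed

lemma bochner_integrable_on_cong:
  fixes f g :: "real \<Rightarrow> 'a::real_normed_vector"
  assumes "\<And>t. t \<in> S \<Longrightarrow> f t = g t"
  shows "bochner_integrable_on f S \<longleftrightarrow> bochner_integrable_on g S"
proof -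
  have "(t \<in> S \<longrightarrow> (\<lambda>i. s i t) \<longlonglongrightarrow> f t) \<longleftrightarrow> (t \<in> S \<longrightarrow> (\<lambda>i. s i t) \<longlonglongrightarrow> g t)" for s :: "nat \<Rightarrow> real \<Rightarrow> 'a" and t
    using assms by auto
  moreover have "(\<lambda>t. indicat_real S t *\<^sub>R norm (f t)) = (\<lambda>t. indicat_real S t *\<^sub>R norm (g t))"
    using assms by (auto simp: indicator_def)
  ultimately show ?thesis
    unfolding bochner_integrable_on_def strongly_measurable_on_def set_integrable_def by presburger
qed

lemma strongly_measurable_on_diff:
  assumes "strongly_measurable_on f S" "strongly_measurable_on g S"
  shows "strongly_measurable_on (\<lambda>t. f t - g t) S"
proof -
  obtain u v where u: "\<And>i::nat. simple_function lebesgue (u i)"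
      "AE t in lebesgue. t \<in> S \<longrightarrow> (\<lambda>i. u i t) \<longlonglongrightarrow> f t"
    and v: "\<And>i::nat. simple_function lebesgue (v i)"
      "AE t in lebesgue. t \<in> S \<longrightarrow> (\<lambda>i. v i t) \<longlonglongrightarrow> g t"
    using assms unfolding strongly_measurable_on_def by blast
  show ?thesis
    unfolding strongly_measurable_on_def
  proof (intro exI[of _ "\<lambda>i t. u i t - v i t"] conjI allI)
    show "simple_function lebesgue (\<lambda>t. u i t - v i t)" for i
      using u(1) v(1) by (rule simple_function_diff)
    show "AE t in lebesgue. t \<in> S \<longrightarrow> (\<lambda>i. u i t - v i t) \<longlonglongrightarrow> f t - g t"
      using u(2) v(2) by eventually_elim (auto intro: tendsto_diff)
  qed
qed

lemma strongly_measurable_on_norm: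
  fixes f :: "real \<Rightarrow> 'a::real_normed_vector"
  assumes f: "strongly_measurable_on f S" and S: "S \<in> sets lebesgue"
  shows "set_borel_measurable lebesgue S (\<lambda>t. norm (f t))"
proof -
  obtain u where u: "\<And>i::nat. simple_function lebesgue (u i)"
      "AE t in lebesgue. t \<in> S \<longrightarrow> (\<lambda>i. u i t) \<longlonglongrightarrow> f t"
    using f unfolding strongly_measurable_on_def by blast
  have [measurable]: "(\<lambda>t. norm (u i t)) \<in> borel_measurable lebesgue" for i
    by (intro borel_measurable_simple_function simple_function_compose1[OF u(1)])
  define w where "w t = lim (\<lambda>i. indicat_real S t *\<^sub>R norm (u i t))" for t
  have "w \<in> borel_measurable lebesgue"
    unfolding w_def using S by measurable
  moreover have "AE t in lebesgue. w t = indicat_real S t *\<^sub>R norm (f t)"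
    using u(2)
  proof eventually_elim
    case (elim t)
    show ?case
    proof (cases "t \<in> S")
      case True
      with elim have "(\<lambda>i. norm (u i t)) \<longlonglongrightarrow> norm (f t)" by (auto intro: tendsto_norm)
      with True show ?thesis by (simp add: w_def limI)
    qed (simp add: w_def)
  qed
  ultimately show ?thesis
    unfolding set_borel_measurable_def by (rule borel_measurable_AE)
qed

lemma bochner_integrable_on_continuous:
  fixes f :: "real \<Rightarrow> 'a::real_normed_vector"
  assumes "continuous_on {a..b} f"
  shows "bochner_integrable_on f {a..b}"
  unfolding bochner_integrable_on_def
  using strongly_measurable_on_continuous[OF assms]
    absolutely_integrable_continuous_real[OF continuous_on_norm[OF assms]] by simp

lemma bochner_integrable_on_diff:
  fixes f :: "real \<Rightarrow> 'a::real_normed_vector"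
  assumes f: "bochner_integrable_on f {a..b}" and g: "bochner_integrable_on g {a..b}"
  shows "bochner_integrable_on (\<lambda>t. f t - g t) {a..b}"
proof -
  have sm: "strongly_measurable_on (\<lambda>t. f t - g t) {a..b}"
    using f g by (auto simp: bochner_integrable_on_def intro: strongly_measurable_on_diff)
  have "set_integrable lebesgue {a..b} (\<lambda>t. norm (f t) + norm (g t))"
    using f g by (auto simp: bochner_integrable_on_def intro: set_integral_add)
  then have "set_integrable lebesgue {a..b} (\<lambda>t. norm (f t - g t))"
    by (rule set_integrable_bound)
       (use strongly_measurable_on_norm[OF sm] in \<open>auto intro: norm_triangle_ineq4\<close>)
  with sm show ?thesis by (simp add: bochner_integrable_on_def)
qed

lemma restrict_in_L1_loc_iff:
  "restrict f I \<in> L1_loc I \<longleftrightarrow> (\<forall>a b. {a..b} \<subseteq> I \<longrightarrow> bochner_integrable_on f {a..b})"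
proof -
  have "bochner_integrable_on (restrict f I) {a..b} \<longleftrightarrow> bochner_integrable_on f {a..b}"
    if "{a..b} \<subseteq> I" for a b
    by (rule bochner_integrable_on_cong) (use that in auto)
  then show ?thesis by (auto simp: L1_loc_def)
qed

lemma continuous_in_L1_loc:
  assumes "continuous_on I f"
  shows "restrict f I \<in> L1_loc I"
  unfolding restrict_in_L1_loc_iff
  using assms continuous_on_subset bochner_integrable_on_continuous by blast

lemma L1_loc_diff:
  assumes "restrict f I \<in> L1_loc I" "restrict g I \<in> L1_loc I"
  shows "restrict (\<lambda>t. f t - g t) I \<in> L1_loc I"
  using assms unfolding restrict_in_L1_loc_iff by (blast intro: bochner_integrable_on_diff)

section \<open>Primitives and increments on half-lines\<close>

text \<open>
  Only the increments of \<open>F\<close> over \<open>[t, t + h]\<close> with \<open>t \<ge> c\<close> are ever used. Stating the relation through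
  them, with the interval moved to \<open>[0, h]\<close> as in the definition of means, treats derivatives that
  exist everywhere and those that exist almost everywhere alike, and is stable under translation.
\<close>

definition is_primitive_from :: "real \<Rightarrow> (real \<Rightarrow> 'x::banach) \<Rightarrow> (real \<Rightarrow> 'x) \<Rightarrow> bool" where
  "is_primitive_from c F f \<longleftrightarrow>
     (\<forall>t\<ge>c. \<forall>h>0. ((\<lambda>s. f (t + s)) has_integral F (t + h) - F t) {0..h})"

lemma is_primitive_fromI:
  assumes "\<And>u v. c \<le> u \<Longrightarrow> u < v \<Longrightarrow> (f has_integral F v - F u) {u..v}"
  shows "is_primitive_from c F f"
  unfolding is_primitive_from_def
proof (intro allI impI)
  fix t h :: real
  assume "t \<ge> c" "h > 0"
  then have "(f has_integral F (t + h) - F t) (cbox (0 + t) (h + t))"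
    using assms[of t "t + h"] by (simp add: add.commute)
  then have "((f \<circ> (+) t) has_integral F (t + h) - F t) (cbox 0 h)"
    by (simp only: has_integral_shift_cbox_iff)
  then show "((\<lambda>s. f (t + s)) has_integral F (t + h) - F t) {0..h}"
    by (simp add: comp_def)
qed

lemma is_primitive_from_derivative:
  assumes "\<And>t. c \<le> t \<Longrightarrow> (F has_vector_derivative f t) (at t within {c..})"
  shows "is_primitive_from c F f"
proof (rule is_primitive_fromI)
  fix u v :: real
  assume "c \<le> u" "u < v"
  then show "(f has_integral F v - F u) {u..v}"
    by (intro fundamental_theorem_of_calculus has_vector_derivative_within_subset[OF assms]) auto
qed

lemma is_primitive_from_translate:
  assumes F: "is_primitive_from c F f" and "c \<le> d + a"
  shows "is_primitive_from d (\<lambda>t. F (t + a)) (\<lambda>t. f (t + a))"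
  unfolding is_primitive_from_def
proof (intro allI impI)
  fix t h :: real assume "t \<ge> d" "h > 0"
  then have "((\<lambda>s. f ((t + a) + s)) has_integral F ((t + a) + h) - F (t + a)) {0..h}"
    using F \<open>c \<le> d + a\<close> unfolding is_primitive_from_def by (auto simp del: add.assoc)
  then show "((\<lambda>s. f (t + s + a)) has_integral F (t + h + a) - F (t + a)) {0..h}"
    by (simp add: ac_simps)
qed

lemma is_primitive_from_mono: "is_primitive_from c F f \<Longrightarrow> c \<le> d \<Longrightarrow> is_primitive_from d F f"
  unfolding is_primitive_from_def by auto

lemma is_primitive_from_add:
  assumes "is_primitive_from c F f" "is_primitive_from c G g"
  shows "is_primitive_from c (\<lambda>t. F t + G t) (\<lambda>t. f t + g t)"
  unfolding is_primitive_from_def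
proof (intro allI impI)
  fix t h :: real assume "t \<ge> c" "h > 0"
  then have "((\<lambda>s. f (t + s) + g (t + s)) has_integral (F (t + h) - F t) + (G (t + h) - G t)) {0..h}"
    using assms unfolding is_primitive_from_def by (intro has_integral_add) auto
  then show "((\<lambda>s. f (t + s) + g (t + s)) has_integral F (t + h) + G (t + h) - (F t + G t)) {0..h}"
    by (simp add: algebra_simps)
qed

lemma is_primitive_from_sum:
  assumes "\<And>x. x \<in> S \<Longrightarrow> is_primitive_from c (F x) (f x)"
  shows "is_primitive_from c (\<lambda>t. \<Sum>x\<in>S. F x t) (\<lambda>t. \<Sum>x\<in>S. f x t)"
  using assms
proof (induction S rule: infinite_finite_induct)
  case (insert x S)
  then show ?case by (simp add: is_primitive_from_add)
qed (auto simp: is_primitive_from_def)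

lemma is_primitive_from_bounded_linear:
  assumes "bounded_linear T" "is_primitive_from c F f"
  shows "is_primitive_from c (\<lambda>t. T (F t)) (\<lambda>t. T (f t))"
  unfolding is_primitive_from_def
proof (intro allI impI)
  fix t h :: real assume "t \<ge> c" "h > 0"
  then have "(T \<circ> (\<lambda>s. f (t + s)) has_integral T (F (t + h) - F t)) {0..h}"
    using assms unfolding is_primitive_from_def by (intro has_integral_linear) auto
  then show "((\<lambda>s. T (f (t + s))) has_integral T (F (t + h)) - T (F t)) {0..h}"
    by (simp add: comp_def bounded_linear.linear[OF assms(1), THEN linear_diff])
qed

definition increment :: "real \<Rightarrow> (real \<Rightarrow> 'x::ab_group_add) \<Rightarrow> real \<Rightarrow> 'x" where
  "increment h f t = f (t + h) - f t"

lemma is_primitive_from_increment: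
  assumes "is_primitive_from c F f" "h > 0"
  shows "is_primitive_from c (increment h F) (increment h f)"
proof -
  have "is_primitive_from c (\<lambda>t. - F t) (\<lambda>t. - f t)"
    by (rule is_primitive_from_bounded_linear[OF bounded_linear_minus[OF bounded_linear_ident] assms(1)])
  with is_primitive_from_translate[OF assms(1)]
  have "is_primitive_from c (\<lambda>t. F (t + h) + - F t) (\<lambda>t. f (t + h) + - f t)"
    by (rule is_primitive_from_add) (use assms(2) in simp)
  then show ?thesis
    by (simp add: increment_def[abs_def])
qed

lemma has_vector_derivative_translate_halfline:
  assumes F: "\<And>t. c \<le> t \<Longrightarrow> (F has_vector_derivative f t) (at t within {c..})"
    and "c \<le> t" "0 \<le> a"
  shows "((\<lambda>t. F (t + a)) has_vector_derivative f (t + a)) (at t within {c..})"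
proof -
  have "((\<lambda>t. t + a) has_vector_derivative 1) (at t within {c..})"
    by (auto intro!: derivative_eq_intros)
  moreover have "(F has_vector_derivative f (t + a)) (at (t + a) within (\<lambda>t. t + a) ` {c..})"
    by (rule has_vector_derivative_within_subset[OF F]) (use assms(2,3) in auto)
  ultimately show ?thesis
    using vector_diff_chain_within by (fastforce simp: comp_def)
qed

lemma continuous_on_translate_halfline:
  assumes "continuous_on {c..} f" "c \<le> d + a"
  shows "continuous_on {d..} (\<lambda>t. f (t + a :: real))"
  by (rule continuous_on_compose2[OF assms(1)]) (use assms(2) in \<open>auto intro!: continuous_intros\<close>)

lemma continuous_on_increment:
  assumes "continuous_on {c..} f" "0 \<le> h"
  shows "continuous_on {c..} (increment h (f :: real \<Rightarrow> 'x::real_normed_vector))"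
  unfolding increment_def
  by (intro continuous_intros continuous_on_translate_halfline[OF assms(1)] assms(1)) (use assms(2) in auto)

lemma vector_derivative_within_halfline:
  assumes "(f has_vector_derivative f') (at t within {c..})" "c \<le> t"
  shows "vector_derivative f (at t within {c..}) = f'"
proof (rule vector_derivative_within[OF _ assms(1)])
  have "t islimpt {t..t+1}" by (rule connected_imp_perfect) (auto)
  then have "t islimpt {c..}" by (rule islimpt_subset) (use assms(2) in auto)
  then show "at t within {c..} \<noteq> bot" by (simp add: trivial_limit_within)
qed

section \<open>Classes of functions subject to the difference condition\<close>

context banach_over
begin

lemma bounded_linear_smul: "bounded_linear (smul c)"
proof (rule bounded_linear_intro[of _ "norm c"])
  show "smul c (u *\<^sub>R x) = u *\<^sub>R smul c x" for u x
    by (simp add: smul_of_real[symmetric] mult.commute)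
qed (auto simp: scale_right_distrib norm_smul mult.commute)

lemma smul_minus_one: "smul (-1) x = - x"
  using smul_of_real[of "-1" x] by simp

end

text \<open>
  The hypotheses on the class \<open>A\<close>; the half-lines are \<open>J = [\<alpha>, \<infinity>)\<close> and \<open>J' = [\<alpha> + r, \<infinity>)\<close>.
\<close>

locale delta_class = banach_over smul
  for smul :: "'k::real_normed_field \<Rightarrow> 'x::banach \<Rightarrow> 'x" +
  fixes \<alpha> r :: real and A :: "(real \<Rightarrow> 'x) set"
  assumes r_le_0: "r \<le> 0"
    and linear: "linear_class smul {\<alpha>..} A"
    and invariant: "positive_invariant {\<alpha>..} A"
    and r_invariant: "r'_invariant \<alpha> r A"
    and Delta1: "Delta1 {\<alpha>..} A"
    and means: "A \<subseteq> mean_class {\<alpha>..} A"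
begin

definition in_class :: "(real \<Rightarrow> 'x) \<Rightarrow> bool" where
  "in_class f \<longleftrightarrow> restrict f {\<alpha>..} \<in> A"

lemma in_class_eq: "in_class f \<Longrightarrow> (\<And>t. \<alpha> \<le> t \<Longrightarrow> f t = g t) \<Longrightarrow> in_class g"
  unfolding in_class_def by (metis atLeast_iff restrict_ext)

lemma in_class_add:
  assumes "in_class f" "in_class g" shows "in_class (\<lambda>t. f t + g t)"
proof -
  have "in_class (\<lambda>t. restrict f {\<alpha>..} t + restrict g {\<alpha>..} t)"
    using assms linear unfolding in_class_def linear_class_def by blast
  then show ?thesis by (rule in_class_eq) simp
qed

lemma in_class_smul:
  assumes "in_class f" shows "in_class (\<lambda>t. smul c (f t))"
proof -
  have "in_class (\<lambda>t. smul c (restrict f {\<alpha>..} t))"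
    using assms linear unfolding in_class_def linear_class_def by blast
  then show ?thesis by (rule in_class_eq) simp
qed

lemma in_class_scaleR: "in_class f \<Longrightarrow> in_class (\<lambda>t. u *\<^sub>R f t)"
  using in_class_smul[of f "of_real u"] by (simp add: smul_of_real)

lemma in_class_diff:
  assumes "in_class f" "in_class g" shows "in_class (\<lambda>t. f t - g t)"
  using in_class_add[OF assms(1) in_class_smul[OF assms(2), of "-1"]] by (simp add: smul_minus_one)

lemma in_class_sum:
  assumes "\<And>x. x \<in> S \<Longrightarrow> in_class (f x)" shows "in_class (\<lambda>t. \<Sum>x\<in>S. f x t)"
  using assms
proof (induction S rule: infinite_finite_induct)
  case (insert x S)
  then show ?case by (simp add: in_class_add)
qed (use linear in \<open>simp_all add: in_class_def linear_class_def\<close>)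

lemma in_class_translate:
  assumes "in_class f" "0 \<le> a" shows "in_class (\<lambda>t. f (t + a))"
proof -
  have "in_class (translate a (restrict f {\<alpha>..}))"
    using assms invariant unfolding in_class_def positive_invariant_def by blast
  then show ?thesis
    by (rule in_class_eq) (use assms(2) in \<open>simp add: translate_def\<close>)
qed

lemma in_class_increment: "in_class f \<Longrightarrow> 0 \<le> h \<Longrightarrow> in_class (increment h f)"
  unfolding increment_def by (intro in_class_diff in_class_translate)

text \<open>
  The translate by \<open>r\<close> is the strongest form of membership: by positive invariance it yields the
  translates by every larger shift.
\<close>

lemma in_class_translate_from_r:
  assumes "in_class (translate r f)" "r \<le> a" shows "in_class (\<lambda>t. f (t + a))"
  using in_class_translate[OF assms(1), of "a - r"] assms(2) by (simp add: translate_def algebra_simps)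

lemma in_class_integral:
  assumes f: "restrict f {\<alpha>..} \<in> mean_class {\<alpha>..} A" and h: "0 < h"
  shows "in_class (\<lambda>t. integral {0..h} (\<lambda>s. f (t + s)))"
proof -
  have "in_class (\<lambda>t. h *\<^sub>R mean h (restrict f {\<alpha>..}) t)"
    using f h by (intro in_class_scaleR) (simp add: in_class_def mean_class_def)
  moreover have "h *\<^sub>R mean h (restrict f {\<alpha>..}) t = integral {0..h} (\<lambda>s. f (t + s))" if "\<alpha> \<le> t" for t
    unfolding mean_def using h that by (auto intro!: integral_cong)
  ultimately show ?thesis by (rule in_class_eq)
qed

lemma in_class_in_mean_class: "in_class f \<Longrightarrow> restrict f {\<alpha>..} \<in> mean_class {\<alpha>..} A"
  using means by (auto simp: in_class_def)

text \<open>
  Averaging lowers the order: \<open>h\<close> times the mean of \<open>g\<close> over \<open>[t, t + h]\<close> is \<open>increment h G\<close>, and the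
  means of \<open>f\<close> can be subtracted because \<open>A \<subseteq> \<M>A\<close>. Continuity of \<open>f\<close> makes the integral split.
\<close>

lemma increment_primitive_in_class:
  assumes fg: "restrict (\<lambda>t. f t + g t) {\<alpha>..} \<in> mean_class {\<alpha>..} A"
    and f: "in_class f" "continuous_on {\<alpha>..} f"
    and g: "is_primitive_from \<alpha> G g" and h: "0 < h"
  shows "in_class (increment h G)"
proof -
  have "in_class (\<lambda>t. integral {0..h} (\<lambda>s. f (t + s) + g (t + s)) - integral {0..h} (\<lambda>s. f (t + s)))"
    by (intro in_class_diff in_class_integral[OF fg h] in_class_integral[OF in_class_in_mean_class[OF f(1)] h])
  moreover have "integral {0..h} (\<lambda>s. f (t + s) + g (t + s)) - integral {0..h} (\<lambda>s. f (t + s))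
      = increment h G t" if t: "\<alpha> \<le> t" for t
  proof -
    have "(\<lambda>s. f (t + s)) integrable_on {0..h}"
      by (intro integrable_continuous_interval continuous_on_compose2[OF f(2)] continuous_intros)
         (use t in auto)
    moreover have "((\<lambda>s. g (t + s)) has_integral G (t + h) - G t) {0..h}"
      using g t h by (simp add: is_primitive_from_def)
    ultimately show ?thesis
      by (simp add: integral_add has_integral_integrable integral_unique increment_def)
  qed
  ultimately show ?thesis by (rule in_class_eq)
qed

text \<open>
  The condition \<open>(\<Delta>\<^sub>1)\<close> applied to \<open>f'\<close> gives \<open>f' - M\<^sub>1 f' \<in> A\<close>, and \<open>M\<^sub>1 f' = increment 1 f\<close> is in
  \<open>A\<close>. This settles \<open>f'\<close> on \<open>[\<alpha>, \<infinity>)\<close> only; the delayed terms of the equation also see \<open>f'\<close> on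
  \<open>[\<alpha> + r, \<alpha>]\<close>, and there \<open>r'\<close>-invariance is needed.
\<close>

lemma derivative_in_class_of_increments:
  assumes der: "\<And>t. \<alpha> + r \<le> t \<Longrightarrow> (f has_vector_derivative f' t) (at t within {\<alpha> + r..})"
    and cont: "continuous_on {\<alpha> + r..} f'"
    and f: "in_class (translate r f)"
    and incr: "\<And>s. 0 < s \<Longrightarrow> in_class (increment s f')"
  shows "in_class (translate r f')"
proof -
  have contJ: "continuous_on {\<alpha>..} f'"
    using cont by (rule continuous_on_subset) (use r_le_0 in auto)
  have prim: "is_primitive_from \<alpha> f f'"
    using is_primitive_from_derivative[OF der] r_le_0 by (rule_tac is_primitive_from_mono) auto
  define \<phi> where "\<phi> = restrict f' {\<alpha>..}"
  have "in_class (\<lambda>t. translate s \<phi> t - \<phi> t)" if "0 < s" for s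
    by (rule in_class_eq[OF incr[OF that]]) (use that in \<open>simp add: increment_def translate_def \<phi>_def\<close>)
  moreover have "\<phi> \<in> L1_loc {\<alpha>..}"
    unfolding \<phi>_def by (rule continuous_in_L1_loc[OF contJ])
  ultimately have "in_class (\<lambda>t. \<phi> t - mean 1 \<phi> t)"
    using Delta1 unfolding Delta1_def in_class_def by blast
  moreover have "mean 1 \<phi> t = increment 1 f t" if "\<alpha> \<le> t" for t
  proof -
    have "mean 1 \<phi> t = integral {0..1} (\<lambda>s. f' (t + s))"
      unfolding mean_def \<phi>_def using that by (auto intro!: integral_cong)
    also have "\<dots> = increment 1 f t"
      using prim that by (simp add: is_primitive_from_def increment_def integral_unique)
    finally show ?thesis .
  qed
  moreover have "in_class (increment 1 f)"
    using in_class_increment[OF in_class_translate_from_r[OF f r_le_0]] by simp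
  ultimately have "in_class (\<lambda>t. (\<phi> t - mean 1 \<phi> t) + increment 1 f t)"
    by (intro in_class_add)
  then have "in_class f'"
    by (rule in_class_eq)
       (simp add: \<phi>_def \<open>\<And>t. \<alpha> \<le> t \<Longrightarrow> mean 1 \<phi> t = increment 1 f t\<close>[unfolded \<phi>_def])
  moreover have deriv: "deriv_on {\<alpha> + r..} 1 f t = f' t" if "\<alpha> + r \<le> t" for t
    using der[OF that] vector_derivative_within_halfline[OF der[OF that] that]
    by (auto simp: differentiable_def has_vector_derivative_def)
  ultimately have "in_class (deriv_on {\<alpha> + r..} 1 f)"
    using r_le_0 by (rule_tac in_class_eq[of f']) auto
  moreover have "f \<in> Ck_on 1 {\<alpha> + r..}"
  proof -
    have "continuous_on {\<alpha> + r..} (deriv_on {\<alpha> + r..} 1 f)"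
      using cont by (rule continuous_on_eq) (simp only: deriv atLeast_iff)
    then show ?thesis
      using der by (auto simp: Ck_on_def differentiable_def has_vector_derivative_def)
  qed
  ultimately have "in_class (translate r (deriv_on {\<alpha> + r..} 1 f))"
    using r_invariant f unfolding r'_invariant_def in_class_def by blast
  then show ?thesis
    by (rule in_class_eq) (simp only: translate_def deriv add_right_mono)
qed

end

section \<open>Differential-difference operators and reduction of the order\<close>

locale delayed_delta_class = delta_class smul \<alpha> r A
  for smul :: "'k::real_normed_field \<Rightarrow> 'x::banach \<Rightarrow> 'x" and \<alpha> r A +
  fixes q :: nat and \<rho> :: "nat \<Rightarrow> real"
  assumes shifts: "\<And>k. k \<in> {1..q} \<Longrightarrow> r \<le> \<rho> k"
begin

definition shift_op :: "(nat \<Rightarrow> 'k^'n::finite^'n) \<Rightarrow> ('n \<Rightarrow> real \<Rightarrow> 'x) \<Rightarrow> 'n \<Rightarrow> real \<Rightarrow> 'x" where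
  "shift_op c f i t = (\<Sum>k=1..q. \<Sum>l\<in>UNIV. smul (c k $ i $ l) (f l (t + \<rho> k)))"

lemma shift_op_in_class:
  assumes "\<And>l. in_class (translate r (f l))"
  shows "in_class (shift_op c f i)"
  unfolding shift_op_def
  by (intro in_class_sum in_class_smul in_class_translate_from_r[OF assms] shifts)

lemma shift_op_increment: "shift_op c (\<lambda>l. increment h (f l)) i = increment h (shift_op c f i)"
  by (simp add: fun_eq_iff shift_op_def increment_def scale_right_diff_distrib sum_subtractf ac_simps)

lemma shift_op_primitive:
  assumes "\<And>l. is_primitive_from (\<alpha> + r) (F l) (f l)"
  shows "is_primitive_from \<alpha> (shift_op c F i) (shift_op c f i)"
  unfolding shift_op_def
  by (intro is_primitive_from_sum is_primitive_from_bounded_linear[OF bounded_linear_smul]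
      is_primitive_from_translate[OF assms]) (use shifts in auto)

lemma shift_op_continuous:
  assumes "\<And>l. continuous_on {\<alpha> + r..} (f l)"
  shows "continuous_on {\<alpha>..} (shift_op c f i)"
  unfolding shift_op_def
  by (intro continuous_on_sum bounded_linear.continuous_on[OF bounded_linear_smul]
      continuous_on_translate_halfline[OF assms]) (use shifts in auto)

text \<open>
  The operator of the theorem on a sequence \<open>Y 0, Y 1, \<dots>\<close> in the place of \<open>y, y', \<dots>\<close>. Decoupling the
  entries from the derivatives of one function makes the shift of coefficients and of derivatives
  in the lemmas below a matter of reindexing.
\<close>

definition diff_op ::
    "nat \<Rightarrow> (nat \<Rightarrow> nat \<Rightarrow> 'k^'n::finite^'n) \<Rightarrow> (nat \<Rightarrow> 'n \<Rightarrow> real \<Rightarrow> 'x) \<Rightarrow> 'n \<Rightarrow> real \<Rightarrow> 'x" where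
  "diff_op N a Y i t = Y N i t + (\<Sum>j<N. shift_op (a j) (Y j) i t)"

lemma diff_op_increment: "diff_op N a (\<lambda>j l. increment h (Y j l)) i = increment h (diff_op N a Y i)"
  by (simp add: fun_eq_iff diff_op_def shift_op_increment)
     (simp add: increment_def diff_op_def sum_subtractf)

lemma diff_op_Suc:
  "diff_op (Suc N) a Y i t
    = shift_op (a 0) (Y 0) i t + diff_op N (\<lambda>j. a (Suc j)) (\<lambda>j. Y (Suc j)) i t"
  unfolding diff_op_def sum.lessThan_Suc_shift by (simp add: ac_simps)

lemma diff_op_primitive:
  assumes "\<And>j l. j \<le> N \<Longrightarrow> is_primitive_from (\<alpha> + r) (Y j l) (Y (Suc j) l)"
  shows "is_primitive_from \<alpha> (diff_op N a Y i) (diff_op N a (\<lambda>j. Y (Suc j)) i)"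
  unfolding diff_op_def
  by (intro is_primitive_from_add is_primitive_from_sum shift_op_primitive
      is_primitive_from_mono[of "\<alpha> + r" _ _ \<alpha>])
     (use assms r_le_0 in auto)

text \<open>
  The operator of order \<open>N + 1\<close> is \<open>shift_op (a 0) (Y 0)\<close> plus the derivative of an operator of order
  \<open>N\<close> applied to \<open>Y\<close>; the first summand has means in \<open>A\<close> since \<open>Y 0\<close> is in \<open>A\<close>, and the means of the
  second are multiples of increments.
\<close>

lemma reduce_order:
  assumes op: "restrict (diff_op (Suc N) a Y i) {\<alpha>..} \<in> mean_class {\<alpha>..} A"
    and prim: "\<And>j l. j \<le> N \<Longrightarrow> is_primitive_from (\<alpha> + r) (Y j l) (Y (Suc j) l)"
    and cont: "\<And>l. continuous_on {\<alpha> + r..} (Y 0 l)"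
    and base: "\<And>l. in_class (translate r (Y 0 l))"
    and h: "0 < h"
  shows "in_class (increment h (diff_op N (\<lambda>j. a (Suc j)) Y i))"
proof (rule increment_primitive_in_class[OF _ _ _ _ h])
  show "is_primitive_from \<alpha> (diff_op N (\<lambda>j. a (Suc j)) Y i) (diff_op N (\<lambda>j. a (Suc j)) (\<lambda>j. Y (Suc j)) i)"
    by (rule diff_op_primitive) (rule prim)
  show "restrict (\<lambda>t. shift_op (a 0) (Y 0) i t + diff_op N (\<lambda>j. a (Suc j)) (\<lambda>j. Y (Suc j)) i t) {\<alpha>..}
      \<in> mean_class {\<alpha>..} A"
    using op by (simp add: diff_op_Suc[abs_def])
qed (auto intro: shift_op_in_class shift_op_continuous base cont)

text \<open>
  The induction on the order. The hypothesis concerns increments rather than the operator itself,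
  because this form is what averaging produces and what it reproduces for \<open>increment h (Y j)\<close>.
\<close>

lemma derivatives_in_class:
  assumes der: "\<And>j l t. j < N \<Longrightarrow> \<alpha> + r \<le> t \<Longrightarrow>
      (Y j l has_vector_derivative Y (Suc j) l t) (at t within {\<alpha> + r..})"
    and cont: "\<And>l. continuous_on {\<alpha> + r..} (Y N l)"
    and base: "\<And>l. in_class (translate r (Y 0 l))"
    and incr: "\<And>h i. 0 < h \<Longrightarrow> in_class (increment h (diff_op N b Y i))"
    and "j \<le> N"
  shows "in_class (translate r (Y j l))"
  using assms
proof (induction N arbitrary: Y b j l)
  case 0
  then show ?case by simp
next
  case (Suc N)
  note der = Suc.prems(1) and base = Suc.prems(3) and incr = Suc.prems(4)
  have cont: "continuous_on {\<alpha> + r..} (Y j l)" if "j \<le> Suc N" for j l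
  proof (cases "j = Suc N")
    case False
    then have "j < Suc N" using that by simp
    from der[OF this] show ?thesis
      by (intro continuous_on_vector_derivative) auto
  qed (use Suc.prems(2) in simp)
  have incr_low: "in_class (increment h (Y j l))" if h: "0 < h" and j: "j \<le> N" for h j l
  proof -
    \<comment> \<open>For fixed \<open>h\<close>, the increments of \<open>Y\<close> satisfy an equation of order \<open>N + 1\<close> with right-hand side
      in the class, hence in the class of means; averaging it reduces the order to \<open>N\<close>.\<close>
    define Z where "Z j l = increment h (Y j l)" for j l
    have derZ: "(Z j l has_vector_derivative Z (Suc j) l t) (at t within {\<alpha> + r..})"
      if "j < Suc N" "\<alpha> + r \<le> t" for j l t
      unfolding Z_def increment_def
      by (intro has_vector_derivative_diff has_vector_derivative_translate_halfline der) (use that h in auto)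
    have contZ: "continuous_on {\<alpha> + r..} (Z j l)" if "j \<le> Suc N" for j l
      unfolding Z_def using h by (intro continuous_on_increment cont that) simp
    have baseZ: "in_class (translate r (Z 0 l))" for l
      using in_class_increment[OF base, of h] h
      by (simp add: Z_def increment_def[abs_def] translate_def ac_simps)
    have "in_class (translate r (Z j l))"
    proof (rule Suc.IH[of Z "\<lambda>j. b (Suc j)"])
      show "in_class (increment s (diff_op N (\<lambda>j. b (Suc j)) Z i))" if "0 < s" for s i
      proof (rule reduce_order)
        show "restrict (diff_op (Suc N) b Z i) {\<alpha>..} \<in> mean_class {\<alpha>..} A"
          unfolding Z_def diff_op_increment by (rule in_class_in_mean_class[OF incr[OF h]])
        show "is_primitive_from (\<alpha> + r) (Z j l) (Z (Suc j) l)" if "j \<le> N" for j l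
          by (rule is_primitive_from_derivative[OF derZ]) (use that in auto)
      qed (use contZ baseZ that in auto)
    qed (use derZ contZ baseZ j in auto)
    from in_class_translate_from_r[OF this r_le_0] show ?thesis by (simp add: Z_def)
  qed
  have low: "in_class (translate r (Y j l))" if "j \<le> N" for j l
    using that
  proof (induction j)
    case (Suc j)
    show ?case
      by (rule derivative_in_class_of_increments[OF der cont Suc.IH incr_low]) (use Suc.prems in auto)
  qed (rule base)
  \<comment> \<open>All terms of the operator below the top are now in the class, and so are their increments.\<close>
  have incr_top: "in_class (increment h (Y (Suc N) l))" if h: "0 < h" for h l
  proof -
    have "in_class (\<lambda>t. increment h (diff_op (Suc N) b Y l) t
        - (\<Sum>j<Suc N. increment h (shift_op (b j) (Y j) l) t))"
      by (intro in_class_diff incr[OF h] in_class_sum in_class_increment shift_op_in_class low)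
         (use h in auto)
    then show ?thesis
      by (rule in_class_eq) (simp add: diff_op_def increment_def sum_subtractf algebra_simps)
  qed
  have "in_class (translate r (Y (Suc N) l))" for l
    by (rule derivative_in_class_of_increments[OF der cont low incr_top]) auto
  with low \<open>j \<le> Suc N\<close> show ?case by (cases "j = Suc N") auto
qed

end

section \<open>Sobolev functions and the theorem\<close>

lemma W1_loc_has_vector_derivative:
  assumes y: "y \<in> W1_loc m {c..}" and "Suc j < m" "c \<le> t"
  shows "(deriv_on {c..} j y has_vector_derivative deriv_on {c..} (Suc j) y t) (at t within {c..})"
proof -
  have "deriv_on {c..} j y differentiable (at t within {c..})"
    using assms by (auto simp: W1_loc_def Ck_on_def)
  then show ?thesis by (simp add: vector_derivative_works)
qed

text \<open>
  Here \<open>deriv_on {c..} (Suc n) y\<close> is a derivative almost everywhere only, and absolute continuity of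
  \<open>deriv_on {c..} n y\<close> makes it integrate back.
\<close>

lemma W1_loc_is_primitive:
  fixes y :: "real \<Rightarrow> 'x::banach"
  assumes y: "y \<in> W1_loc (Suc n) {c..}"
  shows "is_primitive_from c (deriv_on {c..} n y) (deriv_on {c..} (Suc n) y)"
proof (rule is_primitive_fromI)
  fix u v :: real
  assume uv: "c \<le> u" "u < v"
  let ?N = "{t. \<not> (t \<in> {c..} \<longrightarrow> deriv_on {c..} n y differentiable (at t within {c..}))}"
  have "AE t in lebesgue. t \<in> {c..} \<longrightarrow> deriv_on {c..} n y differentiable (at t within {c..})"
    using y by (simp add: W1_loc_def)
  then have N: "negligible ?N"
    by (simp add: negligible_iff_null_sets AE_iff_null_sets completion.AE_iff_null_sets)
  have ac: "abs_continuous_on {u..v} (deriv_on {c..} n y)"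
    using y uv by (simp add: W1_loc_def)
  show "(deriv_on {c..} (Suc n) y has_integral deriv_on {c..} n y v - deriv_on {c..} n y u) {u..v}"
  proof (rule has_integral_derivative_of_abs_continuous[OF _ ac N])
    fix t assume t: "t \<in> {u..v} - ?N"
    then have "deriv_on {c..} n y differentiable (at t within {c..})" using uv by auto
    then have "(deriv_on {c..} n y has_vector_derivative deriv_on {c..} (Suc n) y t) (at t within {c..})"
      by (simp add: vector_derivative_works)
    then show "(deriv_on {c..} n y has_vector_derivative deriv_on {c..} (Suc n) y t) (at t within {u..v})"
      by (rule has_vector_derivative_within_subset) (use uv in auto)
  qed (use uv in simp)
qed

theorem theorem10p1:
  fixes smul :: "'k::real_normed_field \<Rightarrow> 'x::banach \<Rightarrow> 'x"
    and \<alpha> r :: real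
    and m q :: nat
    and a :: "nat \<Rightarrow> nat \<Rightarrow> 'k^'n::finite^'n"
    and \<rho> :: "nat \<Rightarrow> real"
    and J J' :: "real set"
    and A :: "(real \<Rightarrow> 'x) set"
    and y :: "'n \<Rightarrow> real \<Rightarrow> 'x"
  assumes "banach_over smul"
    and "1 \<le> m" and "1 \<le> q"
    and "strict_mono_on {1..q} \<rho>" and "0 \<in> \<rho> ` {1..q}"
    and "r = \<rho> 1"
    and "J = {\<alpha>..}" and "J' = {\<alpha> + r..}"
    and "A \<subseteq> L1_loc J"
    and "linear_class smul J A"
    and "positive_invariant J A"
    and "r'_invariant \<alpha> r A"
    and "Delta1 J A"
    and "A \<subseteq> mean_class J A"
    and "\<forall>i. y i \<in> W1_loc m J'"
    and "\<forall>i. restrict (translate r (y i)) J \<in> A"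
    and "\<forall>i. restrict (diff_difference_op smul J' m q a \<rho> y i) J \<in> mean_class J A"
  shows "(\<forall>j i. 0 < j \<and> j < m \<longrightarrow> restrict (translate r (deriv_on J' j (y i))) J \<in> A) \<and>
         (\<forall>i. restrict (deriv_on J' m (y i)) J \<in> mean_class J A)"
proof -
  note [simp] = \<open>J = {\<alpha>..}\<close> \<open>J' = {\<alpha> + r..}\<close>
  have shifts: "r \<le> \<rho> k" if "k \<in> {1..q}" for k
    using strict_mono_on_imp_mono_on[OF \<open>strict_mono_on {1..q} \<rho>\<close>] that \<open>1 \<le> q\<close>
    unfolding \<open>r = \<rho> 1\<close> by (auto intro: mono_onD)
  then have "r \<le> 0" using \<open>0 \<in> \<rho> ` {1..q}\<close> by fastforce
  interpret delayed_delta_class smul \<alpha> r A q \<rho>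
    using assms(1,10-14) \<open>r \<le> 0\<close> shifts
    unfolding delayed_delta_class_def delta_class_def delta_class_axioms_def delayed_delta_class_axioms_def
    by simp
  obtain n where m: "m = Suc n" using \<open>1 \<le> m\<close> by (cases m) auto
  have y: "y i \<in> W1_loc (Suc n) {\<alpha> + r..}" for i using \<open>\<forall>i. y i \<in> W1_loc m J'\<close> m by simp
  define Y where "Y j l = deriv_on {\<alpha> + r..} j (y l)" for j l
  have der: "(Y j l has_vector_derivative Y (Suc j) l t) (at t within {\<alpha> + r..})"
    if "j < n" "\<alpha> + r \<le> t" for j l t
    unfolding Y_def by (rule W1_loc_has_vector_derivative[OF y]) (use that in auto)
  have prim: "is_primitive_from (\<alpha> + r) (Y j l) (Y (Suc j) l)" if "j \<le> n" for j l
  proof (cases "j = n")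
    case True
    then show ?thesis unfolding Y_def by (simp only: W1_loc_is_primitive[OF y])
  next
    case False
    then show ?thesis using that by (intro is_primitive_from_derivative der) auto
  qed
  have cont: "continuous_on {\<alpha> + r..} (Y j l)" if "j \<le> n" for j l
  proof (cases "j = n")
    case True
    then show ?thesis using y[of l] by (simp add: Y_def W1_loc_def Ck_on_def)
  next
    case False
    then show ?thesis using that by (intro continuous_on_vector_derivative[OF der]) auto
  qed
  have base: "in_class (translate r (Y 0 l))" for l
    using assms(16) by (simp add: in_class_def Y_def)
  have op: "restrict (diff_op (Suc n) a Y i) {\<alpha>..} \<in> mean_class {\<alpha>..} A" for i
  proof -
    have "diff_op (Suc n) a Y i = diff_difference_op smul J' m q a \<rho> y i"
      by (simp add: fun_eq_iff diff_op_def shift_op_def diff_difference_op_def Y_def m translate_def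
          del: deriv_on.simps sum.lessThan_Suc)
    then show ?thesis using assms(17) by simp
  qed
  have low: "in_class (translate r (Y j l))" if "j \<le> n" for j l
    using der cont[OF order_refl] base
      reduce_order[OF op prim cont[OF le0] base] that
    by (rule derivatives_in_class)
  \<comment> \<open>For the top derivative, the means are multiples of increments of \<open>Y n\<close>; the equation itself
    serves to obtain local integrability.\<close>
  have "restrict (Y (Suc n) i) {\<alpha>..} \<in> mean_class {\<alpha>..} A" for i
  proof -
    have "continuous_on {\<alpha>..} (\<lambda>t. \<Sum>j<Suc n. shift_op (a j) (Y j) i t)"
      by (intro continuous_on_sum shift_op_continuous cont) auto
    moreover have "restrict (diff_op (Suc n) a Y i) {\<alpha>..} \<in> L1_loc {\<alpha>..}"
      using op[of i] by (simp add: mean_class_def)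
    ultimately
    have "restrict (\<lambda>t. diff_op (Suc n) a Y i t - (\<Sum>j<Suc n. shift_op (a j) (Y j) i t)) {\<alpha>..} \<in> L1_loc {\<alpha>..}"
      by (intro L1_loc_diff[OF _ continuous_in_L1_loc])
    then have "restrict (Y (Suc n) i) {\<alpha>..} \<in> L1_loc {\<alpha>..}"
      by (simp add: diff_op_def del: sum.lessThan_Suc cong: restrict_cong)
    moreover have "in_class (mean h (restrict (Y (Suc n) i) {\<alpha>..}))" if h: "0 < h" for h
    proof -
      have "in_class (\<lambda>t. (1 / h) *\<^sub>R increment h (Y n i) t)"
        using in_class_translate_from_r[OF low r_le_0] h
        by (intro in_class_scaleR in_class_increment) simp_all
      then show ?thesis
      proof (rule in_class_eq)
        fix t assume t: "\<alpha> \<le> t"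
        have "integral {0..h} (\<lambda>s. restrict (Y (Suc n) i) {\<alpha>..} (t + s))
            = integral {0..h} (\<lambda>s. Y (Suc n) i (t + s))"
          using t by (intro integral_cong) auto
        also have "\<dots> = increment h (Y n i) t"
          using prim[of n i] h t r_le_0 by (simp add: is_primitive_from_def increment_def integral_unique)
        finally show "(1 / h) *\<^sub>R increment h (Y n i) t = mean h (restrict (Y (Suc n) i) {\<alpha>..}) t"
          by (simp add: mean_def)
      qed
    qed
    ultimately show ?thesis by (simp add: mean_class_def in_class_def)
  qed
  with low show ?thesis by (simp add: m in_class_def Y_def del: deriv_on.simps)
qed

end
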